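(* Let $d\ge2$ and let $p_0,\dots,p_d>0$ be constants with $\sum_{i=0}^d p_i=1$. Consider the Diaconis and Freedman's chain $(Z_n)_{n\ge0}$ on $\Delta_d$ with constant weights $p_i(\mathbf{x})=p_i$, $i=0,\dots,d$. Then its unique invariant probability density $g_\infty$ is the density of the Dirichlet distribution $Dir[p_0,\dots,p_d]$, i.e. $$g_\infty(\mathbf{y})=\frac{1}{\prod_{i=0}^d\Gamma(p_i)}\prod_{i=0}^d y_i^{p_i-1}\ \mathbf{1}_{\mathring{\Delta}_d}(\mathbf{y}),\qquad y_0:=1-y_1-\dots-y_d .$$
   Context: $\Delta_d=\{\mathbf{x}\in\mathbb{R}^d: x_i\ge0,\ x_1+\dots+x_d\le 1\}$ is the closed simplex with interior $\mathring{\Delta}_d$ and vertices $\mathbf{e}_0=(0,\dots,0)$ and $\mathbf{e}_i$ the $i$-th standard basis vector, $1\le i\le d$. Given nonnegative continuous weight functions $p_0,\dots,p_d$ on $\Delta_d$ with $\sum_{i=0}^d p_i(\mathbf{x})=1$, the Diaconis and Freedman's chain $(Z_n)_{n\ge0}$ is the Markov chain on $\Delta_d$ which, when at $\mathbf{x}$, chooses the vertex $\mathbf{e}_i$ with probability $p_i(\mathbf{x})$ and then moves to $t\mathbf{x}+(1-t)\mathbf{e}_i$ with $t$ uniform on $(0,1)$. Its transition operator is $Pf(\mathbf{x})=\sum_{i=0}^d p_i(\mathbf{x})\int_0^1 f(t\mathbf{x}+(1-t)\mathbf{e}_i)\,dt$ for bounded measurable $f$. The dual operator $P^*$ on $L^1(\Delta_d)$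 (Lebesgue measure) is defined by $\int_{\Delta_d} Pf\cdot g\,d\mathbf{x}=\int_{\Delta_d} f\cdot P^*g\,d\mathbf{x}$ for all bounded measurable $f$. An invariant probability density is a function $g\in L^1(\Delta_d)$ with $g\ge0$, $\int_{\Delta_d} g=1$ and $P^*g=g$ (uniqueness is as an element of $L^1$). *)

theory Defs
  imports "HOL-Analysis.Analysis"
begin

definition unit_simplex :: "(real ^ 'n) set" where
  "unit_simplex = {x. (\<forall>i. 0 \<le> x $ i) \<and> (\<Sum>i\<in>UNIV. x $ i) \<le> 1}"

text \<open>
  The index set \<open>{0, \<dots>, d}\<close>, with \<open>d = CARD('n)\<close>, is rendered as the type \<open>'n option\<close>:
  \<open>None\<close> stands for the index 0 and \<open>Some i\<close> for the coordinate index \<open>i\<close>.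
\<close>

definition vertex :: "'n option \<Rightarrow> real ^ 'n" where
  "vertex k = (case k of None \<Rightarrow> 0 | Some i \<Rightarrow> axis i 1)"

definition bary_coord :: "real ^ 'n \<Rightarrow> 'n option \<Rightarrow> real" where
  "bary_coord y k = (case k of None \<Rightarrow> 1 - (\<Sum>i\<in>UNIV. y $ i) | Some i \<Rightarrow> y $ i)"

text \<open>The transition operator \<open>P\<close> of the chain with weight functions \<open>p\<close>.\<close>

definition DF_op ::
  "('n option \<Rightarrow> real ^ 'n \<Rightarrow> real) \<Rightarrow> (real ^ 'n \<Rightarrow> real) \<Rightarrow> real ^ 'n \<Rightarrow> real" where
  "DF_op p f x =
    (\<Sum>k\<in>UNIV. p k x *
      (LINT t:{0<..<1}|lborel. f (t *\<^sub>R x + (1 - t) *\<^sub>R vertex k)))"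

text \<open>
  \<open>is_DF_dual p g h\<close> says that \<open>h\<close> represents \<open>P\<^sup>* g\<close> in \<open>L\<^sup>1\<close> of the simplex; the duality
  relation determines \<open>h\<close> only up to Lebesgue null sets. The test functions are Borel
  measurable: \<open>P f\<close> integrates \<open>f\<close> over segments, which are null sets, so it is not defined
  pointwise for a function that is only Lebesgue measurable.
\<close>

definition is_DF_dual ::
  "('n option \<Rightarrow> real ^ 'n \<Rightarrow> real) \<Rightarrow> (real ^ 'n \<Rightarrow> real) \<Rightarrow> (real ^ 'n \<Rightarrow> real) \<Rightarrow> bool" where
  "is_DF_dual p g h \<longleftrightarrow>
    integrable (lebesgue_on unit_simplex) g \<and> integrable (lebesgue_on unit_simplex) h \<and>
    (\<forall>f. f \<in> borel_measurable (restrict_space borel unit_simplex) \<longrightarrow> bounded (f ` unit_simplex) \<longrightarrow>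
      (LINT x|lebesgue_on unit_simplex. DF_op p f x * g x) =
      (LINT x|lebesgue_on unit_simplex. f x * h x))"

definition invariant_density ::
  "('n option \<Rightarrow> real ^ 'n \<Rightarrow> real) \<Rightarrow> (real ^ 'n \<Rightarrow> real) \<Rightarrow> bool" where
  "invariant_density p g \<longleftrightarrow>
    integrable (lebesgue_on unit_simplex) g \<and>
    (AE x in lebesgue_on unit_simplex. 0 \<le> g x) \<and>
    (LINT x|lebesgue_on unit_simplex. g x) = 1 \<and>
    is_DF_dual p g g"

definition dirichlet_density :: "('n option \<Rightarrow> real) \<Rightarrow> real ^ 'n \<Rightarrow> real" where
  "dirichlet_density a y =
    Gamma (\<Sum>k\<in>UNIV. a k) / (\<Prod>k\<in>UNIV. Gamma (a k)) *
    (\<Prod>k\<in>UNIV. bary_coord y k powr (a k - 1)) * indicator (interior unit_simplex) y"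

end

theory Submission
  imports Defs
begin

text \<open>
  Write \<open>b\<^sub>k(y)\<close> for the barycentric coordinates of \<open>y\<close> and \<open>n\<close> for the dimension, and let
  \<open>K\<^sub>a(y) = \<Prod>\<^sub>k b\<^sub>k(y) powr (a\<^sub>k - 1)\<close> on the open simplex be the unnormalised Dirichlet density.

  Invariance rests on the behaviour of \<open>K\<^sub>a\<close> under one move towards a fixed vertex. The substitution
  \<open>y = t x + (1 - t) e\<^sub>k\<close> multiplies every barycentric coordinate by \<open>t\<close>, apart from a shift of
  the \<open>k\<close>-th one by \<open>1 - t\<close>. Its Jacobian \<open>t\<^sup>n\<close> combines with the powers of \<open>t\<close> coming from \<open>K\<^sub>a\<close>
  into \<open>t powr (\<Sum>\<^sub>j a\<^sub>j - 1)\<close>, which is 1 if the parameters sum to 1: this is where the uniform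
  law of \<open>t\<close> fits the weights. What remains of the integral over \<open>t\<close> for fixed \<open>y\<close> is
  \<open>\<integral> (b\<^sub>k(y) - (1 - t)) powr (a\<^sub>k - 1) dt\<close> over \<open>1 - b\<^sub>k(y) < t < 1\<close>, that is
  \<open>b\<^sub>k(y) powr a\<^sub>k / a\<^sub>k\<close>. So a point with density \<open>K\<^sub>a\<close> that moves towards \<open>e\<^sub>k\<close> acquires the density
  \<open>b\<^sub>k / a\<^sub>k \<cdot> K\<^sub>a\<close> (\<open>nn_integral_dirichlet_kernel_move\<close>). If \<open>e\<^sub>k\<close> is chosen with probability
  \<open>a\<^sub>k\<close>, the mixture of these densities is \<open>(\<Sum>\<^sub>k b\<^sub>k) K\<^sub>a = K\<^sub>a\<close>.

  The total mass of \<open>K\<^sub>a\<close> is Dirichlet's integral (\<open>nn_integral_dirichlet_kernel\<close>): the product of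
  the integrals for \<open>\<Gamma>(a\<^sub>k)\<close> is an integral over an orthant of dimension \<open>n + 1\<close>, and slicing the
  orthant along the sum of the coordinates splits off a factor \<open>\<Gamma>(\<Sum>\<^sub>k a\<^sub>k)\<close>.

  Uniqueness holds because the chain contracts. Two copies that use the same vertex and the same
  \<open>t\<close> come closer by the factor \<open>t\<close>, whose mean is \<open>1/2\<close>, so \<open>P\<close> halves Lipschitz constants
  (\<open>lipschitz_on_DF_op\<close>). An invariant density gives \<open>f\<close> and all iterates \<open>P\<^sup>m f\<close> the same
  integral, and these iterates become constant; hence two invariant densities agree on Lipschitz
  functions (\<open>invariant_density_lipschitz_eq\<close>), which are rich enough to determine a density
  almost everywhere (\<open>AE_eq_if_lipschitz_integrals_eq\<close>).
\<close>

section \<open>The simplex in barycentric coordinates\<close>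

lemma sum_UNIV_option:
  fixes f :: "'n::finite option \<Rightarrow> 'b::comm_monoid_add"
  shows "(\<Sum>k\<in>UNIV. f k) = f None + (\<Sum>i\<in>UNIV. f (Some i))"
  by (simp add: UNIV_option_conv sum.reindex)

lemma prod_UNIV_option:
  fixes f :: "'n::finite option \<Rightarrow> 'b::comm_monoid_mult"
  shows "(\<Prod>k\<in>UNIV. f k) = f None * (\<Prod>i\<in>UNIV. f (Some i))"
  by (simp add: UNIV_option_conv prod.reindex)

lemma Basis_vec_real: "(Basis :: (real ^ 'n::finite) set) = range (\<lambda>i. axis i 1)"
  by (auto simp: Basis_vec_def)

lemma inj_axis_1: "inj (\<lambda>i::'n::finite. axis i (1::real))"
  by (auto simp: inj_def axis_eq_axis)

lemma sum_bary_coord: "(\<Sum>k\<in>UNIV. bary_coord (y :: real ^ 'n::finite) k) = 1"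
  by (simp add: sum_UNIV_option bary_coord_def)

lemma bary_coord_affine:
  fixes x :: "real ^ 'n::finite"
  shows "bary_coord (t *\<^sub>R x + (1 - t) *\<^sub>R vertex k) j =
    t * bary_coord x j + (1 - t) * (if j = k then 1 else 0)"
  by (cases j; cases k)
     (auto simp: bary_coord_def vertex_def axis_def sum.distrib sum_distrib_left[symmetric]
        right_diff_distrib)

lemma unit_simplex_eq_convex_hull:
  "unit_simplex = convex hull (insert 0 (Basis :: (real ^ 'n::finite) set))"
  unfolding std_simplex unit_simplex_def
  by (auto simp: Basis_vec_real sum.reindex[OF inj_axis_1] inner_axis)

lemma interior_unit_simplex:
  "interior unit_simplex = {x :: real ^ 'n::finite. \<forall>k. 0 < bary_coord x k}"
proof -
  have "interior unit_simplex = {x :: real ^ 'n. (\<forall>i. 0 < x $ i) \<and> (\<Sum>i\<in>UNIV. x $ i) < 1}"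
    unfolding unit_simplex_eq_convex_hull interior_std_simplex
    by (auto simp: Basis_vec_real sum.reindex[OF inj_axis_1] inner_axis)
  then show ?thesis
    by (auto simp: bary_coord_def split: option.split)
qed

lemma compact_unit_simplex: "compact (unit_simplex :: (real ^ 'n::finite) set)"
  unfolding unit_simplex_eq_convex_hull
  by (intro compact_convex_hull finite_imp_compact) auto

lemma convex_unit_simplex: "convex (unit_simplex :: (real ^ 'n::finite) set)"
  unfolding unit_simplex_eq_convex_hull by (rule convex_convex_hull)

lemma vertex_in_unit_simplex: "vertex k \<in> (unit_simplex :: (real ^ 'n::finite) set)"
  unfolding unit_simplex_eq_convex_hull vertex_def
  by (rule hull_inc) (auto simp: Basis_vec_real split: option.split)

lemma vec_nth_measurable [measurable (raw)]:
  fixes f :: "'a \<Rightarrow> real ^ 'n::finite"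
  assumes "f \<in> borel_measurable M"
  shows "(\<lambda>x. f x $ i) \<in> borel_measurable M"
  using borel_measurable_inner[OF assms borel_measurable_const[of "axis i 1"]]
  by (simp add: inner_axis)

lemma bary_coord_measurable [measurable (raw)]:
  fixes f :: "'a \<Rightarrow> real ^ 'n::finite"
  assumes [measurable]: "f \<in> borel_measurable M"
  shows "(\<lambda>x. bary_coord (f x) k) \<in> borel_measurable M"
  by (cases k) (auto simp: bary_coord_def)

lemma interior_unit_simplex_borel [measurable]:
  "interior unit_simplex \<in> sets (borel :: (real ^ 'n::finite) measure)"
  by simp

section \<open>Dirichlet's integral\<close>

definition dirichlet_kernel :: "('n::finite option \<Rightarrow> real) \<Rightarrow> real ^ 'n \<Rightarrow> real" where
  "dirichlet_kernel a y =
    indicator (interior unit_simplex) y * (\<Prod>k\<in>UNIV. bary_coord y k powr (a k - 1))"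

lemma dirichlet_kernel_measurable [measurable]: "dirichlet_kernel a \<in> borel_measurable borel"
  unfolding dirichlet_kernel_def by measurable

lemma dirichlet_kernel_nonneg: "0 \<le> dirichlet_kernel a y"
  unfolding dirichlet_kernel_def by (intro mult_nonneg_nonneg prod_nonneg) auto

lemma nn_integral_lborel_affine:
  fixes f :: "'a::euclidean_space \<Rightarrow> ennreal"
  assumes [measurable]: "f \<in> borel_measurable borel" and "c \<noteq> 0"
  shows "(\<integral>\<^sup>+y. f y \<partial>lborel) = (\<integral>\<^sup>+x. ennreal (\<bar>c\<bar> ^ DIM('a)) * f (c *\<^sub>R x + t) \<partial>lborel)"
  by (subst lborel_affine[of c t, OF \<open>c \<noteq> 0\<close>])
     (simp add: nn_integral_density nn_integral_distr nn_integral_cmult add.commute)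

lemma nn_integral_lborel_prod_vec:
  fixes f :: "'n::finite \<Rightarrow> real \<Rightarrow> ennreal"
  assumes [measurable]: "\<And>i. f i \<in> borel_measurable borel"
  shows "(\<integral>\<^sup>+z. (\<Prod>i\<in>UNIV. f i (z $ i)) \<partial>(lborel :: (real ^ 'n) measure)) =
    (\<Prod>i\<in>UNIV. \<integral>\<^sup>+t. f i t \<partial>lborel)"
proof -
  define g where "g b = f (inv (\<lambda>i. axis i (1::real)) b)" for b
  have g: "g (axis i 1) = f i" for i
    by (simp add: g_def inv_f_f[OF inj_axis_1])
  have [measurable]: "g b \<in> borel_measurable borel" for b
    by (simp add: g_def)
  show ?thesis
    using nn_integral_lborel_prod[of g]
    by (simp add: Basis_vec_real prod.reindex[OF inj_axis_1] g inner_axis)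
qed

text \<open>
  Below, \<open>H s z\<close> is the integrand for \<open>\<Prod>\<^sub>k \<Gamma>(a\<^sub>k)\<close> at the point of the orthant whose coordinates
  are \<open>z\<close> for the indices \<open>Some i\<close> and \<open>s - \<Sum>\<^sub>i z\<^sub>i\<close> for \<open>None\<close>, so that \<open>s\<close> is the sum of all
  coordinates. The slice at \<open>s > 0\<close> is the simplex scaled by \<open>s\<close>; substituting \<open>z = s y\<close> turns the
  product of exponentials into \<open>exp (- s)\<close> and collects all powers of \<open>s\<close>, Jacobian included,
  in the integrand for \<open>\<Gamma>(\<Sum>\<^sub>k a\<^sub>k)\<close>.
\<close>

theorem nn_integral_dirichlet_kernel:
  fixes a :: "'n::finite option \<Rightarrow> real"
  assumes a: "\<And>k. 0 < a k"
  shows "(\<integral>\<^sup>+y. ennreal (dirichlet_kernel a y) \<partial>lborel) =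
    ennreal ((\<Prod>k\<in>UNIV. Gamma (a k)) / Gamma (\<Sum>k\<in>UNIV. a k))"
proof -
  define A where "A = (\<Sum>k\<in>UNIV. a k)"
  have A: "0 < A"
    unfolding A_def using a by (intro sum_pos) auto
  define \<gamma> where "\<gamma> r t = ennreal (indicator {0..} t * t powr (r - 1) / exp t)" for r t :: real
  have [measurable]: "\<gamma> r \<in> borel_measurable borel" for r
    unfolding \<gamma>_def by measurable
  have \<gamma>: "(\<integral>\<^sup>+t. \<gamma> r t \<partial>lborel) = ennreal (Gamma r)" if "0 < r" for r
    using Gamma_conv_nn_integral_real[OF that] by (simp add: \<gamma>_def)
  define J where "J = (\<integral>\<^sup>+y. ennreal (dirichlet_kernel a y) \<partial>lborel)"
  define H where "H s z = \<gamma> (a None) (s - (\<Sum>i\<in>UNIV. z $ i)) * (\<Prod>i\<in>UNIV. \<gamma> (a (Some i)) (z $ i))"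
    for s and z :: "real ^ 'n"
  have [measurable]: "case_prod H \<in> borel_measurable (borel \<Otimes>\<^sub>M borel)"
    unfolding H_def by measurable
  have H_scale: "ennreal (\<bar>s\<bar> ^ CARD('n)) * H s (s *\<^sub>R y) = \<gamma> A s * ennreal (dirichlet_kernel a y)"
    if s: "0 < s" for s y
  proof (cases "y \<in> interior unit_simplex")
    case True
    define b where "b = bary_coord y"
    have b: "0 < b k" for k
      using True by (simp add: interior_unit_simplex b_def)
    have comp: "s - (\<Sum>i\<in>UNIV. (s *\<^sub>R y) $ i) = s * b None" "\<And>i. (s *\<^sub>R y) $ i = s * b (Some i)"
      by (simp_all add: b_def bary_coord_def sum_distrib_left[symmetric] algebra_simps)
    have "H s (s *\<^sub>R y) = (\<Prod>k\<in>UNIV. \<gamma> (a k) (s * b k))"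
      unfolding H_def comp prod_UNIV_option ..
    also have "\<dots> = (\<Prod>k\<in>UNIV. ennreal (s powr (a k - 1) * b k powr (a k - 1) * exp (- (s * b k))))"
      using s b by (intro prod.cong) (auto simp: \<gamma>_def powr_mult exp_minus field_simps less_imp_le)
    also have "\<dots> = ennreal (\<Prod>k\<in>UNIV. s powr (a k - 1) * b k powr (a k - 1) * exp (- (s * b k)))"
      by (intro prod_ennreal) auto
    also have "(\<Prod>k\<in>UNIV. s powr (a k - 1) * b k powr (a k - 1) * exp (- (s * b k))) =
        s powr (\<Sum>k\<in>UNIV. a k - 1) * dirichlet_kernel a y * exp (\<Sum>k\<in>UNIV. - (s * b k))"
      using s True by (simp add: prod.distrib powr_sum exp_sum dirichlet_kernel_def b_def)
    also have "(\<Sum>k\<in>UNIV. a k - 1) = A - 1 - real CARD('n)"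
      by (simp add: sum_subtractf A_def)
    also have "(\<Sum>k\<in>UNIV. - (s * b k)) = - s"
      by (simp add: sum_negf sum_distrib_left[symmetric] b_def sum_bary_coord)
    also have "s powr (A - 1 - real CARD('n)) = s powr (A - 1) / s ^ CARD('n)"
      using s by (simp add: powr_diff powr_realpow)
    finally show ?thesis
      using s dirichlet_kernel_nonneg[of a y]
      by (simp add: \<gamma>_def ennreal_mult'[symmetric] exp_minus field_simps)
  next
    case False
    then obtain k where k: "bary_coord y k \<le> 0"
      by (auto simp: interior_unit_simplex not_less)
    have "H s (s *\<^sub>R y) = 0"
    proof (cases k)
      case None
      then have "s - (\<Sum>i\<in>UNIV. (s *\<^sub>R y) $ i) \<le> 0"
        using k s by (simp add: bary_coord_def sum_distrib_left[symmetric])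
      then show ?thesis by (auto simp: H_def \<gamma>_def indicator_def)
    next
      case (Some i)
      then have "(s *\<^sub>R y) $ i \<le> 0"
        using k s by (simp add: bary_coord_def mult_nonneg_nonpos)
      then have "\<gamma> (a (Some i)) ((s *\<^sub>R y) $ i) = 0"
        by (auto simp: \<gamma>_def indicator_def)
      then show ?thesis
        unfolding H_def by (subst prod_zero) auto
    qed
    then show ?thesis using False by (simp add: dirichlet_kernel_def)
  qed
  \<comment> \<open>The substitution \<open>z = s y\<close> degenerates at \<open>s = 0\<close>, which is a null set.\<close>
  have slice: "(\<integral>\<^sup>+z. H s z \<partial>lborel) = \<gamma> A s * J" if "s \<noteq> 0" for s
  proof (cases "0 < s")
    case True
    have "(\<integral>\<^sup>+z. H s z \<partial>lborel) =
        (\<integral>\<^sup>+y. ennreal (\<bar>s\<bar> ^ CARD('n)) * H s (s *\<^sub>R y) \<partial>lborel)"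
      using nn_integral_lborel_affine[of "H s" s 0] True by (simp add: DIM_cart)
    then show ?thesis
      by (simp add: H_scale[OF True] J_def nn_integral_cmult)
  next
    case False
    then have "s < 0" using that by simp
    have "H s z = 0" for z
    proof (cases "\<forall>i. 0 \<le> z $ i")
      case True
      then have "0 \<le> (\<Sum>i\<in>UNIV. z $ i)" by (simp add: sum_nonneg)
      then show ?thesis using \<open>s < 0\<close> by (simp add: H_def \<gamma>_def)
    next
      case False
      then obtain i where "z $ i < 0" by (auto simp: not_le)
      then have "\<gamma> (a (Some i)) (z $ i) = 0" by (simp add: \<gamma>_def)
      then show ?thesis unfolding H_def by (subst prod_zero) auto
    qed
    then show ?thesis using \<open>s < 0\<close> by (simp add: \<gamma>_def)
  qed
  have "ennreal (\<Prod>k\<in>UNIV. Gamma (a k)) = (\<Prod>k\<in>UNIV. ennreal (Gamma (a k)))"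
    using a by (subst prod_ennreal) (auto intro: less_imp_le Gamma_real_pos)
  also have "\<dots> = (\<integral>\<^sup>+z. \<gamma> (a None) z \<partial>lborel) * (\<Prod>i\<in>UNIV. \<integral>\<^sup>+t. \<gamma> (a (Some i)) t \<partial>lborel)"
    by (simp add: prod_UNIV_option \<gamma> a)
  also have "\<dots> = (\<integral>\<^sup>+z. (\<integral>\<^sup>+s. \<gamma> (a None) s \<partial>lborel) * (\<Prod>i\<in>UNIV. \<gamma> (a (Some i)) (z $ i))
      \<partial>(lborel :: (real ^ 'n) measure))"
    by (simp add: nn_integral_cmult nn_integral_lborel_prod_vec[of "\<lambda>i. \<gamma> (a (Some i))"])
  also have "\<dots> = (\<integral>\<^sup>+z. (\<integral>\<^sup>+s. H s z \<partial>lborel) \<partial>(lborel :: (real ^ 'n) measure))"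
  proof (intro nn_integral_cong)
    fix z :: "real ^ 'n"
    \<comment> \<open>For fixed \<open>z\<close>, a translation makes the sum of all coordinates the variable of integration.\<close>
    have "(\<integral>\<^sup>+s. \<gamma> (a None) s \<partial>lborel) = (\<integral>\<^sup>+s. \<gamma> (a None) (s - (\<Sum>i\<in>UNIV. z $ i)) \<partial>lborel)"
      using nn_integral_real_affine[of "\<gamma> (a None)" 1 "- (\<Sum>i\<in>UNIV. z $ i)"] by simp
    then show "(\<integral>\<^sup>+s. \<gamma> (a None) s \<partial>lborel) * (\<Prod>i\<in>UNIV. \<gamma> (a (Some i)) (z $ i)) =
        (\<integral>\<^sup>+s. H s z \<partial>lborel)"
      by (simp add: H_def nn_integral_multc)
  qed
  also have "\<dots> = (\<integral>\<^sup>+s. (\<integral>\<^sup>+z. H s z \<partial>lborel) \<partial>lborel)"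
    by (rule lborel_pair.Fubini') measurable
  also have "\<dots> = (\<integral>\<^sup>+s. \<gamma> A s * J \<partial>lborel)"
    by (intro nn_integral_cong_AE eventually_mono[OF AE_lborel_singleton[of 0]]) (simp add: slice)
  also have "\<dots> = ennreal (Gamma A) * J"
    by (simp add: nn_integral_multc \<gamma> A)
  finally have eq: "ennreal (Gamma A) * J = ennreal (\<Prod>k\<in>UNIV. Gamma (a k))" ..
  have pos: "0 < Gamma A" using A by simp
  have "J = ennreal (1 / Gamma A) * (ennreal (Gamma A) * J)"
    using pos by (simp add: mult.assoc[symmetric] ennreal_mult'[symmetric])
  also have "\<dots> = ennreal ((\<Prod>k\<in>UNIV. Gamma (a k)) / Gamma A)"
    unfolding eq using pos by (simp add: ennreal_mult'[symmetric])
  finally show ?thesis by (simp add: J_def A_def)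
qed


section \<open>Moving towards a vertex\<close>

lemma nn_integral_powr_shift:
  fixes b c r :: real
  assumes r: "0 < r" and b: "0 < b" "b \<le> 1"
  shows "(\<integral>\<^sup>+t. ennreal (indicator {0<..<1} t * indicator {0<..} (b - (1 - t)) * (b - (1 - t)) powr (r - 1)) \<partial>lborel) =
    ennreal (b powr r / r)"
proof -
  define f where "f t = ennreal (indicator {0<..<1} t * indicator {0<..} (b - (1 - t)) * (b - (1 - t)) powr (r - 1))"
    for t :: real
  have [measurable]: "f \<in> borel_measurable borel"
    unfolding f_def by measurable
  have "(\<integral>\<^sup>+t. f t \<partial>lborel) = (\<integral>\<^sup>+u. f ((1 - b) + u) \<partial>lborel)"
    using nn_integral_real_affine[of f 1 "1 - b"] by simp
  also have "\<dots> = (\<integral>\<^sup>+u. ennreal (indicator {0..b} u * u powr (r - 1)) \<partial>lborel)"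
    using b
    by (intro nn_integral_cong_AE eventually_mono[OF AE_lborel_singleton[of b]])
       (auto simp: f_def indicator_def)
  also have "\<dots> = ennreal (b powr r / r)"
    using nn_integral_has_integral_lebesgue[OF _ has_integral_powr_from_0[of "r - 1" b]] r b by simp
  finally show ?thesis by (simp add: f_def)
qed

text \<open>
  For \<open>0 < t < 1\<close> and parameters that sum to 1, this is the density at \<open>y\<close> of the image of the
  Dirichlet kernel under \<open>x \<mapsto> t x + (1 - t) e\<^sub>k\<close>. The indicator of \<open>{0<..}\<close> cuts the support
  down to the open simplex shrunk by the factor \<open>t\<close> towards \<open>e\<^sub>k\<close>.
\<close>

definition moved_kernel ::
  "('n::finite option \<Rightarrow> real) \<Rightarrow> 'n option \<Rightarrow> real \<Rightarrow> real ^ 'n \<Rightarrow> real" where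
  "moved_kernel a k t y =
    indicator (interior unit_simplex) y * indicator {0<..} (bary_coord y k - (1 - t)) *
    (bary_coord y k - (1 - t)) powr (a k - 1) * (\<Prod>j\<in>UNIV - {k}. bary_coord y j powr (a j - 1))"

lemma moved_kernel_measurable [measurable]:
  "(\<lambda>(t, y). moved_kernel a k t (y :: real ^ 'n::finite)) \<in> borel_measurable (borel \<Otimes>\<^sub>M borel)"
  unfolding moved_kernel_def by measurable

text \<open>
  The product has \<open>n + 1\<close> factors, so scaling all barycentric coordinates by \<open>t\<close> produces the power
  \<open>\<Sum>\<^sub>j a\<^sub>j - (n + 1)\<close> of \<open>t\<close>, of which the Jacobian \<open>t\<^sup>n\<close> leaves \<open>\<Sum>\<^sub>j a\<^sub>j - 1\<close>.
\<close>

lemma moved_kernel_affine: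
  fixes x :: "real ^ 'n::finite"
  assumes t: "t \<in> {0<..<1}"
  shows "t ^ CARD('n) * moved_kernel a k t (t *\<^sub>R x + (1 - t) *\<^sub>R vertex k) =
    t powr ((\<Sum>j\<in>UNIV. a j) - 1) * dirichlet_kernel a x"
proof -
  define y where "y = t *\<^sub>R x + (1 - t) *\<^sub>R vertex k"
  have yk: "bary_coord y k - (1 - t) = t * bary_coord x k"
    by (simp add: y_def bary_coord_affine)
  have yj: "bary_coord y j = t * bary_coord x j" if "j \<noteq> k" for j
    using that by (simp add: y_def bary_coord_affine)
  have supp: "y \<in> interior unit_simplex \<and> 0 < bary_coord y k - (1 - t) \<longleftrightarrow>
      x \<in> interior unit_simplex"
  proof -
    have "0 < bary_coord y k - (1 - t) \<longleftrightarrow> 0 < bary_coord x k"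
      unfolding yk using t by (simp add: zero_less_mult_iff)
    moreover have "0 < bary_coord y j \<longleftrightarrow> 0 < bary_coord x j" if "j \<noteq> k" for j
      using yj[OF that] t by (simp add: zero_less_mult_iff)
    moreover have "0 < bary_coord y k" if "0 < bary_coord y k - (1 - t)"
      using that t by simp
    ultimately show ?thesis
      unfolding interior_unit_simplex mem_Collect_eq by metis
  qed
  show ?thesis
  proof (cases "x \<in> interior unit_simplex")
    case True
    then have b: "0 \<le> bary_coord x j" for j
      by (auto simp: interior_unit_simplex less_imp_le)
    have "moved_kernel a k t y =
        (t * bary_coord x k) powr (a k - 1) * (\<Prod>j\<in>UNIV - {k}. (t * bary_coord x j) powr (a j - 1))"
      using True supp by (auto simp: moved_kernel_def yk yj)
    also have "\<dots> = (\<Prod>j\<in>UNIV. (t * bary_coord x j) powr (a j - 1))"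
      by (simp add: prod.remove[of UNIV k])
    also have "\<dots> = t powr (\<Sum>j\<in>UNIV. a j - 1) * dirichlet_kernel a x"
      using True t b by (simp add: powr_mult prod.distrib powr_sum dirichlet_kernel_def)
    also have "(\<Sum>j\<in>UNIV. a j - 1) = (\<Sum>j\<in>UNIV. a j) - 1 - real CARD('n)"
      by (simp add: sum_subtractf)
    finally show ?thesis
      using t by (simp add: y_def powr_diff powr_realpow)
  next
    case False
    then show ?thesis
      using supp by (auto simp: moved_kernel_def dirichlet_kernel_def y_def)
  qed
qed

lemma nn_integral_moved_kernel:
  fixes y :: "real ^ 'n::finite"
  assumes a: "0 < a k"
  shows "(\<integral>\<^sup>+t. indicator {0<..<1} t * ennreal (moved_kernel a k t y) \<partial>lborel) =
    ennreal (bary_coord y k / a k * dirichlet_kernel a y)"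
proof (cases "y \<in> interior unit_simplex")
  case True
  define b where "b = bary_coord y k"
  define c where "c = (\<Prod>j\<in>UNIV - {k}. bary_coord y j powr (a j - 1))"
  have pos: "0 < bary_coord y j" for j
    using True by (simp add: interior_unit_simplex)
  have "b \<le> (\<Sum>j\<in>UNIV. bary_coord y j)"
    unfolding b_def using pos by (intro member_le_sum) (auto intro: less_imp_le)
  then have b: "0 < b" "b \<le> 1"
    using pos by (simp_all add: sum_bary_coord b_def)
  have c: "0 \<le> c"
    unfolding c_def by (intro prod_nonneg) auto
  have "(\<integral>\<^sup>+t. indicator {0<..<1} t * ennreal (moved_kernel a k t y) \<partial>lborel) =
      (\<integral>\<^sup>+t. ennreal (indicator {0<..<1} t * indicator {0<..} (b - (1 - t)) * (b - (1 - t)) powr (a k - 1)) *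
        ennreal c \<partial>lborel)"
    using True c by (intro nn_integral_cong)
      (auto simp: moved_kernel_def b_def c_def ennreal_mult'[symmetric] indicator_def)
  also have "\<dots> = ennreal (b powr a k / a k) * ennreal c"
    using nn_integral_powr_shift[OF a b] by (simp add: nn_integral_multc)
  also have "\<dots> = ennreal (b powr a k / a k * c)"
    using c by (simp add: ennreal_mult'[symmetric] ennreal_mult''[symmetric])
  also have "b powr a k / a k * c = b / a k * (b powr (a k - 1) * c)"
    using b by (simp add: powr_diff)
  also have "b powr (a k - 1) * c = dirichlet_kernel a y"
    using True by (simp add: dirichlet_kernel_def b_def c_def prod.remove[of UNIV k])
  finally show ?thesis by (simp add: b_def)
next
  case False
  then show ?thesis by (simp add: moved_kernel_def dirichlet_kernel_def)
qed

text \<open>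
  In probabilistic terms: if \<open>X\<close> has the Dirichlet law with parameters \<open>a\<close>, and \<open>T\<close> is independent
  of \<open>X\<close> with density proportional to \<open>t powr (\<Sum>\<^sub>j a\<^sub>j - 1)\<close>, then \<open>T X + (1 - T) e\<^sub>k\<close> has the Dirichlet
  law in which \<open>a\<^sub>k\<close> is increased by 1. The identity follows by exchanging the integrals over \<open>x\<close>
  and \<open>t\<close>, substituting \<open>y = t x + (1 - t) e\<^sub>k\<close> for each \<open>t\<close>, and exchanging back.
\<close>

theorem nn_integral_dirichlet_kernel_move:
  fixes F :: "real ^ 'n::finite \<Rightarrow> ennreal"
  assumes [measurable]: "F \<in> borel_measurable borel" and a: "0 < a k"
  shows "(\<integral>\<^sup>+x. (\<integral>\<^sup>+t. indicator {0<..<1} t * ennreal (t powr ((\<Sum>j\<in>UNIV. a j) - 1)) *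
        F (t *\<^sub>R x + (1 - t) *\<^sub>R vertex k) \<partial>lborel) * ennreal (dirichlet_kernel a x) \<partial>lborel) =
    (\<integral>\<^sup>+y. F y * ennreal (bary_coord y k / a k * dirichlet_kernel a y) \<partial>lborel)"
proof -
  define K where "K = (\<lambda>x. ennreal (dirichlet_kernel a x))"
  define L where "L = (\<lambda>t y. ennreal (moved_kernel a k t y))"
  have [measurable]: "K \<in> borel_measurable borel"
    "case_prod L \<in> borel_measurable (borel \<Otimes>\<^sub>M borel)"
    unfolding K_def L_def by measurable
  define w where "w t = indicator {0<..<1} t * ennreal (t powr ((\<Sum>j\<in>UNIV. a j) - 1))" for t :: real
  have [measurable]: "w \<in> borel_measurable borel"
    unfolding w_def by measurable
  have slice: "(\<integral>\<^sup>+x. w t * F (t *\<^sub>R x + (1 - t) *\<^sub>R vertex k) * K x \<partial>lborel) =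
      (\<integral>\<^sup>+y. indicator {0<..<1} t * L t y * F y \<partial>lborel)" for t
  proof (cases "t \<in> {0<..<1}")
    case True
    then have [simp]: "\<bar>t\<bar> = t" "t \<noteq> 0" by auto
    have "(\<integral>\<^sup>+y. indicator {0<..<1} t * L t y * F y \<partial>lborel) = (\<integral>\<^sup>+x. ennreal (t ^ CARD('n)) *
        (indicator {0<..<1} t * L t (t *\<^sub>R x + (1 - t) *\<^sub>R vertex k) * F (t *\<^sub>R x + (1 - t) *\<^sub>R vertex k))
        \<partial>lborel)"
      by (subst nn_integral_lborel_affine[of _ t "(1 - t) *\<^sub>R vertex k"]) (simp_all add: DIM_cart)
    also have "\<dots> = (\<integral>\<^sup>+x. w t * F (t *\<^sub>R x + (1 - t) *\<^sub>R vertex k) * K x \<partial>lborel)"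
    proof (intro nn_integral_cong)
      fix x :: "real ^ 'n"
      have "ennreal (t ^ CARD('n)) * L t (t *\<^sub>R x + (1 - t) *\<^sub>R vertex k) = w t * K x"
        using True moved_kernel_affine[OF True, of a k x]
        by (simp add: L_def K_def w_def ennreal_mult'[symmetric])
      then show "ennreal (t ^ CARD('n)) *
        (indicator {0<..<1} t * L t (t *\<^sub>R x + (1 - t) *\<^sub>R vertex k) * F (t *\<^sub>R x + (1 - t) *\<^sub>R vertex k)) =
        w t * F (t *\<^sub>R x + (1 - t) *\<^sub>R vertex k) * K x"
        using True by (simp add: mult.assoc[symmetric]) (simp add: mult_ac)
    qed
    finally show ?thesis ..
  qed (simp add: w_def)
  have "(\<integral>\<^sup>+x. (\<integral>\<^sup>+t. w t * F (t *\<^sub>R x + (1 - t) *\<^sub>R vertex k) \<partial>lborel) * K x \<partial>lborel) =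
      (\<integral>\<^sup>+x. (\<integral>\<^sup>+t. w t * F (t *\<^sub>R x + (1 - t) *\<^sub>R vertex k) * K x \<partial>lborel) \<partial>lborel)"
    by (simp add: nn_integral_multc)
  also have "\<dots> = (\<integral>\<^sup>+t. (\<integral>\<^sup>+x. w t * F (t *\<^sub>R x + (1 - t) *\<^sub>R vertex k) * K x \<partial>lborel) \<partial>lborel)"
    by (rule lborel_pair.Fubini') measurable
  also have "\<dots> = (\<integral>\<^sup>+y. (\<integral>\<^sup>+t. indicator {0<..<1} t * L t y * F y \<partial>lborel) \<partial>lborel)"
    unfolding slice by (rule lborel_pair.Fubini') measurable
  also have "\<dots> = (\<integral>\<^sup>+y. F y * ennreal (bary_coord y k / a k * dirichlet_kernel a y) \<partial>lborel)"
    by (simp add: nn_integral_multc nn_integral_moved_kernel[of a k, OF a] L_def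
        del: times_divide_eq_left) (simp add: mult.commute)
  finally show ?thesis by (simp add: w_def K_def)
qed

section \<open>Invariance of the Dirichlet density\<close>

lemma dirichlet_density_eq:
  fixes a :: "'n::finite option \<Rightarrow> real"
  shows "dirichlet_density a y =
    Gamma (\<Sum>k\<in>UNIV. a k) / (\<Prod>k\<in>UNIV. Gamma (a k)) * dirichlet_kernel a y"
  by (simp add: dirichlet_density_def dirichlet_kernel_def mult_ac)

lemma dirichlet_density_measurable [measurable]:
  "dirichlet_density (a :: 'n::finite option \<Rightarrow> real) \<in> borel_measurable borel"
  unfolding dirichlet_density_eq[abs_def] by measurable

lemma dirichlet_density_nonneg:
  fixes a :: "'n::finite option \<Rightarrow> real"
  assumes "\<And>k. 0 < a k"
  shows "0 \<le> dirichlet_density a y"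
  unfolding dirichlet_density_eq using assms
  by (intro mult_nonneg_nonneg divide_nonneg_nonneg prod_nonneg dirichlet_kernel_nonneg)
     (auto intro!: less_imp_le[OF Gamma_real_pos] sum_pos)

lemma dirichlet_density_eq_0: "y \<notin> unit_simplex \<Longrightarrow> dirichlet_density a y = 0"
  using interior_subset[of unit_simplex] by (auto simp: dirichlet_density_def indicator_def)

lemma nn_integral_dirichlet_density:
  fixes a :: "'n::finite option \<Rightarrow> real"
  assumes a: "\<And>k. 0 < a k"
  shows "(\<integral>\<^sup>+y. ennreal (dirichlet_density a y) \<partial>lborel) = 1"
proof -
  have pos: "0 < Gamma (\<Sum>k\<in>UNIV. a k)" "0 < (\<Prod>k\<in>UNIV. Gamma (a k))"
    using a by (auto intro!: Gamma_real_pos sum_pos prod_pos)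
  define c where "c = Gamma (\<Sum>k\<in>UNIV. a k) / (\<Prod>k\<in>UNIV. Gamma (a k))"
  have "(\<integral>\<^sup>+y. ennreal (dirichlet_density a y) \<partial>lborel) =
      ennreal c * (\<integral>\<^sup>+y. ennreal (dirichlet_kernel a y) \<partial>lborel)"
    unfolding dirichlet_density_eq c_def[symmetric]
    by (simp add: ennreal_mult'' dirichlet_kernel_nonneg nn_integral_cmult)
  then show ?thesis
    using pos by (simp add: nn_integral_dirichlet_kernel[of a, OF a] ennreal_mult'[symmetric] c_def
        del: prod_zero_iff)
qed

lemma integrable_dirichlet_density:
  fixes a :: "'n::finite option \<Rightarrow> real"
  assumes a: "\<And>k. 0 < a k"
  shows "integrable lborel (dirichlet_density a)"
  using nn_integral_dirichlet_density[of a, OF a] dirichlet_density_nonneg[of a, OF a]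
  by (intro integrableI_nonneg) auto

lemma integral_dirichlet_density:
  fixes a :: "'n::finite option \<Rightarrow> real"
  assumes a: "\<And>k. 0 < a k"
  shows "(LINT y|lborel. dirichlet_density a y) = 1"
  using nn_integral_dirichlet_density[of a, OF a] dirichlet_density_nonneg[of a, OF a]
  by (subst integral_eq_nn_integral) auto

lemma set_integrable_bounded_segment:
  fixes f :: "real ^ 'n::finite \<Rightarrow> real"
  assumes [measurable]: "f \<in> borel_measurable borel" and "\<And>x. \<bar>f x\<bar> \<le> B"
  shows "set_integrable lborel {0<..<1} (\<lambda>t. f (t *\<^sub>R x + (1 - t) *\<^sub>R v))"
  unfolding set_integrable_def
proof (rule integrableI_bounded_set_indicator)
  show "AE t in lborel. t \<in> {0<..<1} \<longrightarrow> norm (f (t *\<^sub>R x + (1 - t) *\<^sub>R v)) \<le> B"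
    using assms by simp
qed (use assms in auto)

lemma DF_op_measurable:
  fixes f :: "real ^ 'n::finite \<Rightarrow> real"
  assumes [measurable]: "f \<in> borel_measurable borel"
  shows "DF_op (\<lambda>k x. p k) f \<in> borel_measurable borel"
  unfolding DF_op_def[abs_def] set_lebesgue_integral_def by measurable

lemma DF_op_nonneg:
  assumes "\<And>k. 0 \<le> p k x" "\<And>x. 0 \<le> f x"
  shows "0 \<le> DF_op p f x"
  unfolding DF_op_def set_lebesgue_integral_def using assms
  by (intro sum_nonneg mult_nonneg_nonneg Bochner_Integration.integral_nonneg) auto

lemma ennreal_DF_op:
  fixes f :: "real ^ 'n::finite \<Rightarrow> real"
  assumes [measurable]: "f \<in> borel_measurable borel"
    and f: "\<And>x. 0 \<le> f x" "\<And>x. f x \<le> B" and p: "\<And>k. 0 \<le> p k"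
  shows "ennreal (DF_op (\<lambda>k x. p k) f x) = (\<Sum>k\<in>UNIV. ennreal (p k) *
    (\<integral>\<^sup>+t. indicator {0<..<1} t * ennreal (f (t *\<^sub>R x + (1 - t) *\<^sub>R vertex k)) \<partial>lborel))"
proof -
  have *: "ennreal (LINT t:{0<..<1}|lborel. f (t *\<^sub>R x + (1 - t) *\<^sub>R vertex k)) =
      (\<integral>\<^sup>+t. indicator {0<..<1} t * ennreal (f (t *\<^sub>R x + (1 - t) *\<^sub>R vertex k)) \<partial>lborel)" for k
  proof -
    have "set_integrable lborel {0<..<1} (\<lambda>t. f (t *\<^sub>R x + (1 - t) *\<^sub>R vertex k))"
      using f by (intro set_integrable_bounded_segment[of _ B]) (auto simp: abs_le_iff intro: order_trans)
    then show ?thesis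
      using f unfolding set_lebesgue_integral_def set_integrable_def
      by (subst nn_integral_eq_integral[symmetric])
         (auto simp: indicator_def intro!: nn_integral_cong)
  qed
  have nn: "0 \<le> (LINT t:{0<..<1}|lborel. f (t *\<^sub>R x + (1 - t) *\<^sub>R vertex k))" for k
    unfolding set_lebesgue_integral_def using f by (intro Bochner_Integration.integral_nonneg) auto
  show ?thesis
    unfolding DF_op_def *[symmetric] using p nn
    by (simp add: sum_ennreal[symmetric] ennreal_mult)
qed

text \<open>
  Invariance, tested on nonnegative functions: since \<open>\<Sum>\<^sub>k p\<^sub>k = 1\<close>, the power of \<open>t\<close> in
  \<open>nn_integral_dirichlet_kernel_move\<close> is trivial. Choosing \<open>e\<^sub>k\<close> with probability \<open>p\<^sub>k\<close> cancels the
  \<open>p\<^sub>k\<close> in \<open>b\<^sub>k / p\<^sub>k\<close>, and the coordinates \<open>b\<^sub>k\<close> add up to 1.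
\<close>

lemma nn_integral_DF_op_dirichlet:
  fixes f :: "real ^ 'n::finite \<Rightarrow> real"
  assumes [measurable]: "f \<in> borel_measurable borel"
    and f: "\<And>x. 0 \<le> f x" "\<And>x. f x \<le> B" and p: "\<And>k. 0 < p k" "(\<Sum>k\<in>UNIV. p k) = 1"
  shows "(\<integral>\<^sup>+x. ennreal (DF_op (\<lambda>k x. p k) f x * dirichlet_density p x) \<partial>lborel) =
    (\<integral>\<^sup>+y. ennreal (f y * dirichlet_density p y) \<partial>lborel)"
proof -
  define K where "K = dirichlet_kernel p"
  have K: "0 \<le> K x" for x
    by (simp add: K_def dirichlet_kernel_nonneg)
  have [measurable]: "K \<in> borel_measurable borel"
    by (simp add: K_def)
  define c where "c = Gamma (\<Sum>k\<in>UNIV. p k) / (\<Prod>k\<in>UNIV. Gamma (p k))"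
  have c: "0 \<le> c" unfolding c_def
    using p by (intro divide_nonneg_nonneg prod_nonneg)
      (auto intro!: less_imp_le[OF Gamma_real_pos] sum_pos)
  have D: "dirichlet_density p x = c * K x" for x
    by (simp add: dirichlet_density_eq c_def K_def)
  note [measurable] = DF_op_measurable[OF assms(1), of p]
  have Pf: "0 \<le> DF_op (\<lambda>k x. p k) f x" for x
    using f p by (intro DF_op_nonneg) (auto intro: less_imp_le)
  define G where "G k x = (\<integral>\<^sup>+t. indicator {0<..<1} t *
    ennreal (f (t *\<^sub>R x + (1 - t) *\<^sub>R vertex k)) \<partial>lborel)" for k and x :: "real ^ 'n"
  have [measurable]: "G k \<in> borel_measurable borel" for k
    unfolding G_def by measurable
  have move: "(\<integral>\<^sup>+x. G k x * ennreal (K x) \<partial>lborel) =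
      (\<integral>\<^sup>+y. ennreal (f y) * ennreal (bary_coord y k / p k * K y) \<partial>lborel)" for k
  proof -
    have "G k x = (\<integral>\<^sup>+t. indicator {0<..<1} t * ennreal (t powr ((\<Sum>j\<in>UNIV. p j) - 1)) *
        ennreal (f (t *\<^sub>R x + (1 - t) *\<^sub>R vertex k)) \<partial>lborel)" for x
      unfolding G_def using p by (intro nn_integral_cong) (auto simp: indicator_def)
    then show ?thesis
      using nn_integral_dirichlet_kernel_move[of "\<lambda>y. ennreal (f y)" p k] p by (simp add: K_def)
  qed
  have "(\<integral>\<^sup>+x. ennreal (DF_op (\<lambda>k x. p k) f x * K x) \<partial>lborel) =
      (\<integral>\<^sup>+x. (\<Sum>k\<in>UNIV. ennreal (p k) * (G k x * ennreal (K x))) \<partial>lborel)"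
    using ennreal_DF_op[of f B p] f p K Pf
    by (simp add: ennreal_mult G_def less_imp_le sum_distrib_right mult.assoc)
  also have "\<dots> = (\<Sum>k\<in>UNIV. ennreal (p k) *
      (\<integral>\<^sup>+y. ennreal (f y) * ennreal (bary_coord y k / p k * K y) \<partial>lborel))"
    by (simp add: nn_integral_sum nn_integral_cmult move)
  also have "\<dots> = (\<integral>\<^sup>+y. (\<Sum>k\<in>UNIV. ennreal (p k) *
      (ennreal (f y) * ennreal (bary_coord y k / p k * K y))) \<partial>lborel)"
    by (simp add: nn_integral_sum nn_integral_cmult)
  also have "\<dots> = (\<integral>\<^sup>+y. ennreal (f y * K y) \<partial>lborel)"
  proof (intro nn_integral_cong)
    fix y :: "real ^ 'n"
    have bK: "0 \<le> bary_coord y k * K y" for k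
    proof (cases "y \<in> interior unit_simplex")
      case True
      then show ?thesis using K[of y] by (simp add: interior_unit_simplex less_imp_le)
    qed (simp add: K_def dirichlet_kernel_def)
    have "ennreal (p k) * (ennreal (f y) * ennreal (bary_coord y k / p k * K y)) =
        ennreal (f y * (bary_coord y k * K y))" for k
    proof -
      have "0 \<le> bary_coord y k / p k * K y"
        using p(1)[of k] bK[of k] by simp
      then have "ennreal (p k) * (ennreal (f y) * ennreal (bary_coord y k / p k * K y)) =
          ennreal (p k * (f y * (bary_coord y k / p k * K y)))"
        using p(1)[of k] f by (simp only: ennreal_mult[symmetric] mult_nonneg_nonneg less_imp_le)
      then show ?thesis
        using p(1)[of k] by (simp add: less_imp_neq[symmetric])
    qed
    then have "(\<Sum>k\<in>UNIV. ennreal (p k) * (ennreal (f y) * ennreal (bary_coord y k / p k * K y))) =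
        ennreal (\<Sum>k\<in>UNIV. f y * (bary_coord y k * K y))"
      using f bK by (simp add: sum_ennreal)
    also have "(\<Sum>k\<in>UNIV. f y * (bary_coord y k * K y)) = f y * K y"
      by (simp add: sum_distrib_left[symmetric] sum_distrib_right[symmetric] sum_bary_coord)
    finally show "(\<Sum>k\<in>UNIV. ennreal (p k) *
      (ennreal (f y) * ennreal (bary_coord y k / p k * K y))) = ennreal (f y * K y)" .
  qed
  finally have "ennreal c * (\<integral>\<^sup>+x. ennreal (DF_op (\<lambda>k x. p k) f x * K x) \<partial>lborel) =
      ennreal c * (\<integral>\<^sup>+y. ennreal (f y * K y) \<partial>lborel)"
    by simp
  then show ?thesis
    using c by (simp add: nn_integral_cmult[symmetric] ennreal_mult'[symmetric] D mult_ac)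
qed


lemma unit_simplex_lebesgue [measurable]:
  "(unit_simplex :: (real ^ 'n::finite) set) \<in> sets lebesgue"
  using compact_unit_simplex by (auto intro: lmeasurable_compact fmeasurableD)

lemma
  fixes h :: "real ^ 'n::finite \<Rightarrow> real"
  assumes [measurable]: "h \<in> borel_measurable borel" and h: "\<And>x. x \<notin> unit_simplex \<Longrightarrow> h x = 0"
  shows integral_lebesgue_on_simplex: "(LINT x|lebesgue_on unit_simplex. h x) = (LINT x|lborel. h x)"
    and integrable_lebesgue_on_simplex: "integrable (lebesgue_on unit_simplex) h \<longleftrightarrow> integrable lborel h"
proof -
  have *: "(\<lambda>x. indicator unit_simplex x * h x) = h"
    using h by (intro ext) (auto simp: indicator_def)
  show "(LINT x|lebesgue_on unit_simplex. h x) = (LINT x|lborel. h x)"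
    by (subst integral_restrict_space) (auto simp: * integral_completion)
  show "integrable (lebesgue_on unit_simplex) h \<longleftrightarrow> integrable lborel h"
    by (subst integrable_restrict_space) (auto simp: * integrable_completion)
qed

lemma segment_in_simplex:
  fixes x :: "real ^ 'n::finite"
  assumes "x \<in> unit_simplex" "t \<in> {0<..<1}"
  shows "t *\<^sub>R x + (1 - t) *\<^sub>R vertex k \<in> unit_simplex"
  using assms by (intro convexD[OF convex_unit_simplex] vertex_in_unit_simplex) auto

text \<open>
  A test function is given on the simplex only, and has no sign. Both are repaired by \<open>g\<close>, which is
  \<open>f + B\<close> on the simplex, for a bound \<open>B\<close> of \<open>\<bar>f\<bar>\<close>, and 0 elsewhere. On the simplex, \<open>P g\<close> exceeds
  \<open>P f\<close> by exactly \<open>B\<close>, because the weights sum to 1 and segments to the vertices stay inside.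
\<close>

lemma integral_DF_op_dirichlet:
  fixes f :: "real ^ 'n::finite \<Rightarrow> real"
  assumes f: "f \<in> borel_measurable (restrict_space borel unit_simplex)"
    and bdd: "bounded (f ` unit_simplex)"
    and p: "\<And>k. 0 < p k" "(\<Sum>k\<in>UNIV. p k) = 1"
  shows "(LINT x|lebesgue_on unit_simplex. DF_op (\<lambda>k x. p k) f x * dirichlet_density p x) =
    (LINT x|lebesgue_on unit_simplex. f x * dirichlet_density p x)"
proof -
  obtain B where B: "\<And>x. x \<in> unit_simplex \<Longrightarrow> \<bar>f x\<bar> \<le> B"
    using bdd by (auto simp: bounded_iff)
  define g where "g x = indicator unit_simplex x *\<^sub>R (f x + B)" for x
  define D where "D = dirichlet_density p"
  have D: "0 \<le> D x" for x
    unfolding D_def using p by (intro dirichlet_density_nonneg)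
  have D0: "D x = 0" if "x \<notin> unit_simplex" for x
    using that by (simp add: D_def dirichlet_density_eq_0)
  have [measurable]: "D \<in> borel_measurable borel"
    by (simp add: D_def)
  have [measurable]: "unit_simplex \<in> sets (borel :: (real ^ 'n) measure)"
    using compact_unit_simplex by (intro borel_closed compact_imp_closed)
  have g_meas [measurable]: "g \<in> borel_measurable borel"
  proof -
    have "(\<lambda>x. f x + B) \<in> borel_measurable (restrict_space borel unit_simplex)"
      using f by measurable
    then show ?thesis
      unfolding g_def by (subst (asm) borel_measurable_restrict_space_iff) auto
  qed
  have g: "0 \<le> g x" "g x \<le> 2 * \<bar>B\<bar>" for x
    using B[of x] by (auto simp: g_def indicator_def abs_le_iff)
  define Pg where "Pg = DF_op (\<lambda>k x. p k) g"
  have [measurable]: "Pg \<in> borel_measurable borel"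
    unfolding Pg_def by (rule DF_op_measurable) measurable
  have Pg: "0 \<le> Pg x" for x
    unfolding Pg_def using p g by (intro DF_op_nonneg) (auto intro: less_imp_le)
  have intD: "integrable lborel D" "(LINT x|lborel. D x) = 1"
    unfolding D_def using p by (auto intro!: integrable_dirichlet_density integral_dirichlet_density)
  have intg: "integrable lborel (\<lambda>x. g x * D x)"
    using g D by (intro Bochner_Integration.integrable_bound[OF integrable_mult_right[OF intD(1), of "2 * \<bar>B\<bar>"]])
       (auto intro!: AE_I2 mult_right_mono simp: abs_mult)
  have nn: "(\<integral>\<^sup>+x. ennreal (Pg x * D x) \<partial>lborel) = (\<integral>\<^sup>+x. ennreal (g x * D x) \<partial>lborel)"
    unfolding Pg_def D_def using nn_integral_DF_op_dirichlet[OF g_meas g, of p] p by simp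
  have eq: "(LINT x|lborel. Pg x * D x) = (LINT x|lborel. g x * D x)"
    using Pg g D by (simp add: integral_eq_nn_integral nn)
  have intPg: "integrable lborel (\<lambda>x. Pg x * D x)"
    using intg Pg g D nn by (subst integrable_iff_bounded) (auto simp: integrable_iff_bounded)
  have Pf: "DF_op (\<lambda>k x. p k) f x = Pg x - B" if x: "x \<in> unit_simplex" for x
  proof -
    have "(LINT t:{0<..<1}|lborel. f (t *\<^sub>R x + (1 - t) *\<^sub>R vertex k)) =
        (LINT t:{0<..<1}|lborel. g (t *\<^sub>R x + (1 - t) *\<^sub>R vertex k)) - B" for k
    proof -
      have "(LINT t:{0<..<1}|lborel. f (t *\<^sub>R x + (1 - t) *\<^sub>R vertex k)) =
          (LINT t:{0<..<1::real}|lborel. g (t *\<^sub>R x + (1 - t) *\<^sub>R vertex k) - B)"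
        using segment_in_simplex[OF x]
        by (intro set_lebesgue_integral_cong) (auto simp: g_def)
      also have "\<dots> = (LINT t:{0<..<1}|lborel. g (t *\<^sub>R x + (1 - t) *\<^sub>R vertex k)) -
          (LINT t:{0<..<1::real}|lborel. B)"
        using g
        by (intro set_integral_diff set_integrable_bounded_segment[of _ "2 * \<bar>B\<bar>"])
           (auto simp: set_integrable_def)
      finally show ?thesis by (simp add: set_lebesgue_integral_def)
    qed
    then show ?thesis
      using p by (simp add: DF_op_def Pg_def right_diff_distrib sum_subtractf sum_distrib_right[symmetric])
  qed
  have "(LINT x|lebesgue_on unit_simplex. DF_op (\<lambda>k x. p k) f x * D x) =
      (LINT x|lebesgue_on unit_simplex. Pg x * D x - B * D x)"
    by (intro Bochner_Integration.integral_cong) (auto simp: Pf left_diff_distrib)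
  also have "\<dots> = (LINT x|lborel. Pg x * D x - B * D x)"
    by (intro integral_lebesgue_on_simplex) (auto simp: D0)
  also have "\<dots> = (LINT x|lborel. g x * D x - B * D x)"
    using intPg intg intD by (simp add: eq)
  also have "\<dots> = (LINT x|lebesgue_on unit_simplex. g x * D x - B * D x)"
    by (intro integral_lebesgue_on_simplex[symmetric]) (auto simp: D0)
  also have "\<dots> = (LINT x|lebesgue_on unit_simplex. f x * D x)"
    by (intro Bochner_Integration.integral_cong) (auto simp: g_def algebra_simps)
  finally show ?thesis by (simp add: D_def)
qed

theorem invariant_density_dirichlet:
  fixes p :: "'n::finite option \<Rightarrow> real"
  assumes p: "\<And>k. 0 < p k" "(\<Sum>k\<in>UNIV. p k) = 1"
  shows "invariant_density (\<lambda>k x. p k) (dirichlet_density p)"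
proof -
  have "integrable (lebesgue_on unit_simplex) (dirichlet_density p)"
    using p by (subst integrable_lebesgue_on_simplex)
      (auto simp: dirichlet_density_eq_0 intro!: integrable_dirichlet_density)
  moreover have "(LINT x|lebesgue_on unit_simplex. dirichlet_density p x) = 1"
    using p by (subst integral_lebesgue_on_simplex)
      (auto simp: dirichlet_density_eq_0 intro!: integral_dirichlet_density)
  ultimately show ?thesis
    using p by (auto simp: invariant_density_def is_DF_dual_def
      intro!: AE_I2 dirichlet_density_nonneg integral_DF_op_dirichlet)
qed

section \<open>Uniqueness by contraction\<close>

text \<open>
  For each vertex, the points reached from \<open>x\<close> and \<open>y\<close> with the same \<open>t\<close> have distance
  \<open>t \<cdot> dist x y\<close>, and \<open>t\<close> has mean \<open>1/2\<close>. The bound holds on the whole space, not just on the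
  simplex, which allows the operator to be iterated without restricting functions.
\<close>

lemma lipschitz_on_DF_op:
  fixes f :: "real ^ 'n::finite \<Rightarrow> real"
  assumes f: "L-lipschitz_on UNIV f" and p: "\<And>k. 0 \<le> p k" "(\<Sum>k\<in>UNIV. p k) = 1"
  shows "(L / 2)-lipschitz_on UNIV (DF_op (\<lambda>k x. p k) f)"
proof (rule lipschitz_onI)
  show "0 \<le> L / 2" using lipschitz_on_nonneg[OF f] by simp
next
  fix x y :: "real ^ 'n"
  define I where "I k x = (LINT t:{0<..<1}|lborel. f (t *\<^sub>R x + (1 - t) *\<^sub>R vertex k))"
    for k and x :: "real ^ 'n"
  have cont: "continuous_on UNIV f"
    by (rule lipschitz_on_continuous_on[OF f])
  have intI: "set_integrable lborel {0<..<1} (\<lambda>t. f (t *\<^sub>R x + (1 - t) *\<^sub>R vertex k))"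
    for k and x :: "real ^ 'n"
  proof -
    have "continuous_on {0..1::real} (\<lambda>t. f (t *\<^sub>R x + (1 - t) *\<^sub>R vertex k))"
      by (intro continuous_on_compose2[OF cont] continuous_intros) auto
    then have "set_integrable lborel {0..1} (\<lambda>t. f (t *\<^sub>R x + (1 - t) *\<^sub>R vertex k))"
      by (rule borel_integrable_atLeastAtMost')
    then show ?thesis by (rule set_integrable_subset) auto
  qed
  have half: "(LINT t:{0<..<1::real}|lborel. t * c) = c / 2"
     and half_int: "set_integrable lborel {0<..<1::real} (\<lambda>t. t * c)" for c :: real
  proof -
    have "has_bochner_integral lborel (\<lambda>t. indicator {0..1} t *\<^sub>R (t * c)) (1\<^sup>2 / 2 * c - 0\<^sup>2 / 2 * c)"
      by (rule has_bochner_integral_FTC_Icc)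
        (auto intro!: derivative_eq_intros continuous_intros simp flip: has_real_derivative_iff_has_vector_derivative)
    then have h: "has_bochner_integral lborel (\<lambda>t. indicator {0..1} t *\<^sub>R (t * c)) (c / 2)" by simp
    then have i: "set_integrable lborel {0..1} (\<lambda>t. t * c)"
      unfolding set_integrable_def by (rule integrable.intros)
    then show "set_integrable lborel {0<..<1} (\<lambda>t. t * c)"
      by (rule set_integrable_subset) auto
    have "(LINT t:{0<..<1::real}|lborel. t * c) = (LINT t:{0..1::real}|lborel. t * c)"
      unfolding set_lebesgue_integral_def
      by (intro integral_cong_AE eventually_mono[OF AE_conjI[OF AE_lborel_singleton[of 0] AE_lborel_singleton[of 1]]])
         (auto simp: indicator_def)
    then show "(LINT t:{0<..<1::real}|lborel. t * c) = c / 2"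
      using has_bochner_integral_integral_eq[OF h] by (simp only: set_lebesgue_integral_def)
  qed
  have I: "\<bar>I k x - I k y\<bar> \<le> L / 2 * dist x y" for k
  proof -
    have "\<bar>I k x - I k y\<bar> = \<bar>LINT t:{0<..<1}|lborel. f (t *\<^sub>R x + (1 - t) *\<^sub>R vertex k) -
        f (t *\<^sub>R y + (1 - t) *\<^sub>R vertex k)\<bar>"
      unfolding I_def by (simp add: set_integral_diff intI)
    also have "\<dots> \<le> (LINT t:{0<..<1}|lborel. \<bar>f (t *\<^sub>R x + (1 - t) *\<^sub>R vertex k) -
        f (t *\<^sub>R y + (1 - t) *\<^sub>R vertex k)\<bar>)"
      using set_integral_norm_bound[OF set_integral_diff(1)[OF intI intI], of x k y k] by simp
    also have "\<dots> \<le> (LINT t:{0<..<1::real}|lborel. t * (L * dist x y))"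
    proof (rule set_integral_mono)
      show "set_integrable lborel {0<..<1} (\<lambda>t. \<bar>f (t *\<^sub>R x + (1 - t) *\<^sub>R vertex k) -
        f (t *\<^sub>R y + (1 - t) *\<^sub>R vertex k)\<bar>)"
        using set_integrable_norm[OF set_integral_diff(1)[OF intI intI], of x k y k] by simp
      fix t :: real assume t: "t \<in> {0<..<1}"
      have "\<bar>f (t *\<^sub>R x + (1 - t) *\<^sub>R vertex k) - f (t *\<^sub>R y + (1 - t) *\<^sub>R vertex k)\<bar> \<le>
          L * dist (t *\<^sub>R x + (1 - t) *\<^sub>R vertex k) (t *\<^sub>R y + (1 - t) *\<^sub>R vertex k)"
        unfolding dist_real_def[symmetric] by (rule lipschitz_onD[OF f]) auto
      also have "dist (t *\<^sub>R x + (1 - t) *\<^sub>R vertex k) (t *\<^sub>R y + (1 - t) *\<^sub>R vertex k) = t * dist x y"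
        using t by (simp add: dist_norm scaleR_diff_right[symmetric])
      finally show "\<bar>f (t *\<^sub>R x + (1 - t) *\<^sub>R vertex k) - f (t *\<^sub>R y + (1 - t) *\<^sub>R vertex k)\<bar> \<le>
          t * (L * dist x y)" by (simp add: mult_ac)
    qed (rule half_int)
    also have "\<dots> = L / 2 * dist x y"
      by (simp only: half)
    finally show ?thesis .
  qed
  have "dist (DF_op (\<lambda>k x. p k) f x) (DF_op (\<lambda>k x. p k) f y) = \<bar>\<Sum>k\<in>UNIV. p k * (I k x - I k y)\<bar>"
    by (simp add: DF_op_def I_def dist_real_def right_diff_distrib sum_subtractf)
  also have "\<dots> \<le> (\<Sum>k\<in>UNIV. \<bar>p k * (I k x - I k y)\<bar>)"
    by (rule sum_abs)
  also have "\<dots> \<le> (\<Sum>k\<in>UNIV. p k * (L / 2 * dist x y))"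
    using p I by (intro sum_mono) (simp only: abs_mult abs_of_nonneg mult_left_mono)
  also have "\<dots> = L / 2 * dist x y"
    by (simp only: sum_distrib_right[symmetric] p(2) mult_1_left)
  finally show "dist (DF_op (\<lambda>k x. p k) f x) (DF_op (\<lambda>k x. p k) f y) \<le> L / 2 * dist x y" .
qed

lemma lipschitz_bounded_on_simplex:
  fixes f :: "real ^ 'n::finite \<Rightarrow> real"
  assumes "L-lipschitz_on UNIV f"
  shows "bounded (f ` unit_simplex)"
  using lipschitz_on_continuous_on[OF assms] compact_unit_simplex
  by (intro compact_imp_bounded compact_continuous_image) (auto intro: continuous_on_subset)

lemma integrable_lipschitz_mult:
  fixes f :: "real ^ 'n::finite \<Rightarrow> real"
  assumes f: "L-lipschitz_on UNIV f" and g: "integrable (lebesgue_on unit_simplex) g"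
  shows "integrable (lebesgue_on unit_simplex) (\<lambda>x. f x * g x)"
proof -
  obtain B where B: "\<And>x. x \<in> unit_simplex \<Longrightarrow> \<bar>f x\<bar> \<le> \<bar>B\<bar>"
    using lipschitz_bounded_on_simplex[OF f] by (auto simp: bounded_iff) (meson abs_ge_self order_trans)
  have "f \<in> borel_measurable borel"
    using lipschitz_on_continuous_on[OF f] by (rule borel_measurable_continuous_onI)
  then have [measurable]: "f \<in> borel_measurable (lebesgue_on unit_simplex)"
    by (intro measurable_restrict_space1 measurable_completion) simp
  have [measurable]: "g \<in> borel_measurable (lebesgue_on unit_simplex)"
    using g by auto
  show ?thesis
    using B by (intro Bochner_Integration.integrable_bound[OF integrable_mult_right[OF integrable_norm[OF g], of B]])
      (auto intro!: AE_I2 mult_right_mono simp: abs_mult)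
qed

text \<open>
  The integral of an \<open>L\<close>-Lipschitz function against a probability density on the simplex differs
  from its value at the vertex 0 by at most \<open>L R\<close>, where \<open>R\<close> bounds the norm on the simplex; so for two
  densities the integrals differ by at most \<open>2 L R\<close>. If both densities are invariant, the
  function may first be replaced by its image under \<open>P\<close>, which halves \<open>L\<close>, any number of times.
\<close>

lemma invariant_density_lipschitz_eq:
  fixes f :: "real ^ 'n::finite \<Rightarrow> real"
  assumes f: "L-lipschitz_on UNIV f" and p: "\<And>k. 0 \<le> p k" "(\<Sum>k\<in>UNIV. p k) = 1"
    and g: "invariant_density (\<lambda>k x. p k) g" and h: "invariant_density (\<lambda>k x. p k) h"
  shows "(LINT x|lebesgue_on unit_simplex. f x * g x) = (LINT x|lebesgue_on unit_simplex. f x * h x)"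
proof -
  obtain R where R: "\<And>x :: real ^ 'n. x \<in> unit_simplex \<Longrightarrow> norm x \<le> R"
    using compact_imp_bounded[OF compact_unit_simplex] by (auto simp: bounded_iff)
  have step: "(LINT x|lebesgue_on unit_simplex. f x * g x) =
      (LINT x|lebesgue_on unit_simplex. DF_op (\<lambda>k x. p k) f x * g x)"
    if "L-lipschitz_on UNIV f" "invariant_density (\<lambda>k x. p k) g" for L g and f :: "real ^ 'n \<Rightarrow> real"
  proof -
    have "f \<in> borel_measurable (restrict_space borel unit_simplex)"
      using lipschitz_on_continuous_on[OF that(1)]
      by (intro measurable_restrict_space1 borel_measurable_continuous_onI)
    then show ?thesis
      using that lipschitz_bounded_on_simplex[OF that(1)]
      by (auto simp: invariant_density_def is_DF_dual_def)
  qed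
  have near: "\<bar>(LINT x|lebesgue_on unit_simplex. f x * g x) - f 0\<bar> \<le> L * R"
    if f: "L-lipschitz_on UNIV f" and inv: "invariant_density (\<lambda>k x. p k) g"
    for L g and f :: "real ^ 'n \<Rightarrow> real"
  proof -
    have g: "integrable (lebesgue_on unit_simplex) g" "AE x in lebesgue_on unit_simplex. 0 \<le> g x"
      "(LINT x|lebesgue_on unit_simplex. g x) = 1"
      using inv by (auto simp: invariant_density_def)
    note fg = integrable_lipschitz_mult[OF f g(1)]
    have "\<bar>(LINT x|lebesgue_on unit_simplex. f x * g x) - f 0\<bar> =
        \<bar>LINT x|lebesgue_on unit_simplex. f x * g x - f 0 * g x\<bar>"
      using g fg by simp
    also have "\<dots> \<le> (LINT x|lebesgue_on unit_simplex. \<bar>f x * g x - f 0 * g x\<bar>)"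
      by (rule integral_abs_bound)
    also have "\<dots> \<le> (LINT x|lebesgue_on unit_simplex. L * R * g x)"
    proof (rule integral_mono_AE)
      have "AE x in lebesgue_on unit_simplex. x \<in> unit_simplex"
        by (rule AE_I2) simp
      with g(2) show "AE x in lebesgue_on unit_simplex. \<bar>f x * g x - f 0 * g x\<bar> \<le> L * R * g x"
      proof eventually_elim
        fix x :: "real ^ 'n" assume x: "0 \<le> g x" "x \<in> unit_simplex"
        have "\<bar>f x - f 0\<bar> \<le> L * norm x"
          using lipschitz_onD[OF f, of x 0] by (simp add: dist_real_def)
        also have "\<dots> \<le> L * R"
          using R[OF x(2)] lipschitz_on_nonneg[OF f] by (rule mult_left_mono)
        finally show "\<bar>f x * g x - f 0 * g x\<bar> \<le> L * R * g x"
          using x by (simp add: left_diff_distrib[symmetric] abs_mult mult_right_mono)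
      qed
    qed (use g fg in auto)
    finally show ?thesis using g by simp
  qed
  have bound: "\<bar>(LINT x|lebesgue_on unit_simplex. f x * g x) - (LINT x|lebesgue_on unit_simplex. f x * h x)\<bar>
      \<le> 2 * L * R * (1 / 2) ^ n" if "L-lipschitz_on UNIV f" for n L and f :: "real ^ 'n \<Rightarrow> real"
    using that
  proof (induction n arbitrary: L f)
    case 0
    show ?case using near[OF 0 g] near[OF 0 h] by simp
  next
    case (Suc n)
    have "\<bar>(LINT x|lebesgue_on unit_simplex. DF_op (\<lambda>k x. p k) f x * g x) -
        (LINT x|lebesgue_on unit_simplex. DF_op (\<lambda>k x. p k) f x * h x)\<bar> \<le> 2 * (L / 2) * R * (1 / 2) ^ n"
      by (rule Suc.IH[OF lipschitz_on_DF_op[OF Suc.prems p]])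
    then show ?case
      by (simp add: step[OF Suc.prems g] step[OF Suc.prems h])
  qed
  have "(\<lambda>n. 2 * L * R * (1 / 2) ^ n) \<longlonglongrightarrow> 2 * L * R * 0"
    by (intro tendsto_intros LIMSEQ_power_zero) simp
  then have "\<bar>(LINT x|lebesgue_on unit_simplex. f x * g x) - (LINT x|lebesgue_on unit_simplex. f x * h x)\<bar> \<le> 2 * L * R * 0"
    by (rule LIMSEQ_le_const) (use bound[OF f] in auto)
  then show ?thesis by simp
qed

text \<open>
  The indicator of a closed set \<open>C\<close> is the limit of the Lipschitz functions
  \<open>max 0 (1 - n \<cdot> infdist x C)\<close>, and the indicator of a countable union of closed sets is the limit
  of those of the finite unions. By dominated convergence, equality of integrals passes to both. Up
  to a null set, this covers every Lebesgue measurable set.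
\<close>

lemma AE_eq_if_lipschitz_integrals_eq:
  fixes g h :: "'a::euclidean_space \<Rightarrow> real"
  assumes S: "S \<in> sets lebesgue"
    and g: "integrable (lebesgue_on S) g" and h: "integrable (lebesgue_on S) h"
    and eq: "\<And>L f. L-lipschitz_on UNIV f \<Longrightarrow> bounded (range f) \<Longrightarrow>
      (LINT x|lebesgue_on S. f x * g x) = (LINT x|lebesgue_on S. f x * h x)"
  shows "AE x in lebesgue_on S. g x = h x"
proof (rule density_unique_real[OF g h])
  have borel [measurable]: "C \<in> sets (lebesgue_on S)" if "C \<in> sets borel" "C \<subseteq> S" for C
    using that S by (auto simp: sets_restrict_space_iff)
  have meas: "f \<in> borel_measurable (lebesgue_on S)" if "f \<in> borel_measurable borel" for f :: "'a \<Rightarrow> real"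
    using that by (intro measurable_restrict_space1 measurable_completion) simp
  have lim: "(\<lambda>n. LINT x|lebesgue_on S. f n x * u x) \<longlonglongrightarrow> (LINT x|lebesgue_on S. f' x * u x)"
    if f: "\<And>n. f n \<in> borel_measurable borel" "\<And>n x. \<bar>f n x\<bar> \<le> 1" "\<And>x. (\<lambda>n. f n x) \<longlonglongrightarrow> f' x"
      and u: "integrable (lebesgue_on S) u" for f and f' u :: "'a \<Rightarrow> real"
  proof (rule integral_dominated_convergence[where w = "\<lambda>x. norm (u x)"])
    have [measurable]: "f n \<in> borel_measurable (lebesgue_on S)" for n
      using f(1) by (rule meas)
    have [measurable]: "f' \<in> borel_measurable (lebesgue_on S)"
      using f(3) by (rule borel_measurable_LIMSEQ_metric[rotated]) measurable
    have [measurable]: "u \<in> borel_measurable (lebesgue_on S)"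
      using u by auto
    show "(\<lambda>x. f' x * u x) \<in> borel_measurable (lebesgue_on S)"
      "(\<lambda>x. f n x * u x) \<in> borel_measurable (lebesgue_on S)" for n
      by measurable
    show "AE x in lebesgue_on S. (\<lambda>n. f n x * u x) \<longlonglongrightarrow> f' x * u x"
      using f(3) by (intro AE_I2 tendsto_intros)
    show "AE x in lebesgue_on S. norm (f n x * u x) \<le> norm (u x)" for n
      using f(2)[of n] by (intro AE_I2) (simp add: abs_mult mult_left_le_one_le)
  qed (use u in auto)
  have closed_eq: "(LINT x|lebesgue_on S. indicator C x * g x) = (LINT x|lebesgue_on S. indicator C x * h x)"
    if C: "closed C" for C
  proof (cases "C = {}")
    case False
    define f where "f n x = max 0 (1 - real n * infdist x C)" for n x
    have lip: "(real n)-lipschitz_on UNIV (f n)" for n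
    proof (rule lipschitz_onI)
      fix x y
      have "\<bar>f n x - f n y\<bar> \<le> \<bar>real n * infdist x C - real n * infdist y C\<bar>"
        by (simp add: f_def)
      also have "\<dots> = real n * \<bar>infdist x C - infdist y C\<bar>"
        by (simp add: right_diff_distrib[symmetric] abs_mult)
      also have "\<dots> \<le> real n * dist x y"
        by (intro mult_left_mono infdist_triangle_abs) simp
      finally show "dist (f n x) (f n y) \<le> real n * dist x y" by (simp add: dist_real_def)
    qed simp
    have abs_f: "\<bar>f n x\<bar> \<le> 1" for n x
      by (auto simp: f_def infdist_nonneg)
    have f_lim: "(\<lambda>n. f n x) \<longlonglongrightarrow> indicator C x" for x
    proof (cases "x \<in> C")
      case True
      then show ?thesis by (simp add: f_def)
    next
      case x: False
      then have pos: "0 < infdist x C"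
        using C False by (simp add: infdist_pos_not_in_closed)
      obtain N where N: "1 < real N * infdist x C"
        using reals_Archimedean3[OF pos] by blast
      have "f n x = 0" if "N \<le> n" for n
      proof -
        have "real N * infdist x C \<le> real n * infdist x C"
          using that pos by (intro mult_right_mono) auto
        then show ?thesis using N by (simp add: f_def)
      qed
      then show ?thesis
        using x by (intro tendsto_eventually eventually_sequentiallyI[of N]) simp
    qed
    have f_meas: "f n \<in> borel_measurable borel" for n
      using lipschitz_on_continuous_on[OF lip] by (rule borel_measurable_continuous_onI)
    have "(LINT x|lebesgue_on S. f n x * g x) = (LINT x|lebesgue_on S. f n x * h x)" for n
      using abs_f by (intro eq[OF lip]) (auto simp: bounded_iff)
    then show ?thesis
      using lim[OF f_meas abs_f f_lim g] lim[OF f_meas abs_f f_lim h] by (auto intro: LIMSEQ_unique)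
  qed simp
  fix A assume A: "A \<in> sets (lebesgue_on S)"
  then have "A \<in> sets lebesgue"
    using S by (auto simp: sets_restrict_space_iff)
  then obtain C N where CN: "fsigma C" "N \<in> null_sets lebesgue" "C \<union> N = A"
    using lebesgue_set_almost_fsigma by metis
  then obtain F :: "nat \<Rightarrow> 'a set" where F: "\<And>n. closed (F n)" "C = (\<Union>n. F n)"
    by (auto elim: fsigma.cases)
  define E where "E n = (\<Union>i\<le>n. F i)" for n
  have E: "closed (E n)" for n
    unfolding E_def using F(1) by (intro closed_UN) auto
  have E_lim: "(\<lambda>n. indicator (E n) x) \<longlonglongrightarrow> (indicator C x :: real)" for x
  proof -
    have "C = (\<Union>n. E n)"
      unfolding F(2) E_def by auto
    moreover have "incseq E"
      unfolding E_def by (intro monoI UN_mono) auto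
    ultimately show ?thesis
      using LIMSEQ_indicator_incseq[of E x] by simp
  qed
  have E_meas: "(indicator (E n) :: 'a \<Rightarrow> real) \<in> borel_measurable borel" for n
    using E by (intro borel_measurable_indicator borel_closed)
  have E_abs: "\<bar>indicator (E n) x :: real\<bar> \<le> 1" for n x
    by (simp add: indicator_def)
  have C_eq: "(LINT x|lebesgue_on S. indicator C x * g x) = (LINT x|lebesgue_on S. indicator C x * h x)"
    using lim[OF E_meas E_abs E_lim g] lim[OF E_meas E_abs E_lim h]
    by (simp add: closed_eq[OF E] LIMSEQ_unique)
  have N: "AE x in lebesgue_on S. x \<notin> N"
    using AE_not_in[OF CN(2)] S by (auto simp: AE_restrict_space_iff elim: eventually_mono)
  have A_eq: "(LINT x:A|lebesgue_on S. u x) = (LINT x|lebesgue_on S. indicator C x * u x)"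
    if u: "integrable (lebesgue_on S) u" for u :: "'a \<Rightarrow> real"
    unfolding set_lebesgue_integral_def
  proof (rule integral_cong_AE)
    have [measurable]: "u \<in> borel_measurable (lebesgue_on S)" using u by auto
    show "(\<lambda>x. indicator A x *\<^sub>R u x) \<in> borel_measurable (lebesgue_on S)"
      using A by measurable
    have "(indicator C :: 'a \<Rightarrow> real) \<in> borel_measurable borel"
      using F by (intro borel_measurable_indicator) (auto intro!: borel_closed)
    note C = meas[OF this]
    show "(\<lambda>x. indicator C x * u x) \<in> borel_measurable (lebesgue_on S)"
      by (rule borel_measurable_times[OF C]) measurable
    show "AE x in lebesgue_on S. indicator A x *\<^sub>R u x = indicator C x * u x"
      using N by eventually_elim (use CN(3) in \<open>auto simp: indicator_def\<close>)
  qed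
  show "(LINT x:A|lebesgue_on S. g x) = (LINT x:A|lebesgue_on S. h x)"
    by (simp add: A_eq g h C_eq)
qed

theorem invariant_density_unique:
  fixes g h :: "real ^ 'n::finite \<Rightarrow> real"
  assumes p: "\<And>k. 0 \<le> p k" "(\<Sum>k\<in>UNIV. p k) = 1"
    and g: "invariant_density (\<lambda>k x. p k) g" and h: "invariant_density (\<lambda>k x. p k) h"
  shows "AE x in lebesgue_on unit_simplex. g x = h x"
proof (rule AE_eq_if_lipschitz_integrals_eq)
  show "integrable (lebesgue_on unit_simplex) g" "integrable (lebesgue_on unit_simplex) h"
    using g h by (auto simp: invariant_density_def)
  show "(LINT x|lebesgue_on unit_simplex. f x * g x) = (LINT x|lebesgue_on unit_simplex. f x * h x)"
    if "L-lipschitz_on UNIV f" for L f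
    using invariant_density_lipschitz_eq[OF that p g h] .
qed simp

theorem theorem12:
  fixes p :: "'n::finite option \<Rightarrow> real"
  assumes "CARD('n) \<ge> 2"
    and "\<And>k. 0 < p k"
    and "(\<Sum>k\<in>UNIV. p k) = 1"
  shows "invariant_density (\<lambda>k x. p k) (dirichlet_density p) \<and>
         (\<forall>g. invariant_density (\<lambda>k x. p k) g \<longrightarrow>
           (AE y in lebesgue_on unit_simplex. g y = dirichlet_density p y)) \<and>
         (\<forall>y. dirichlet_density p y =
           1 / (\<Prod>k\<in>UNIV. Gamma (p k)) *
           (\<Prod>k\<in>UNIV. bary_coord y k powr (p k - 1)) * indicator (interior unit_simplex) y)"
proof (intro conjI allI impI)
  show inv: "invariant_density (\<lambda>k x. p k) (dirichlet_density p)"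
    using assms(2,3) by (rule invariant_density_dirichlet)
  show "AE y in lebesgue_on unit_simplex. g y = dirichlet_density p y"
    if "invariant_density (\<lambda>k x. p k) g" for g
    using assms(2,3) by (intro invariant_density_unique[OF _ _ that inv]) (auto intro: less_imp_le)
  show "dirichlet_density p y =
      1 / (\<Prod>k\<in>UNIV. Gamma (p k)) *
      (\<Prod>k\<in>UNIV. bary_coord y k powr (p k - 1)) * indicator (interior unit_simplex) y" for y
    by (simp add: dirichlet_density_def assms(3))
qed

end
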